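(* Let $G$ be a finite, simple, connected graph with at least three vertices and $\dim_f(G)=\frac{|V(G)|}{2}$. Let $H$ be a finite, simple, connected graph with $|V(H)|\leq |V(G)|$. Then $\dim_f(G\Box H)=\frac{|V(G)|}{2}$.
   Context: The cartesian product $G\Box H$ has vertex set $V(G)\times V(H)$, with $(u_1,v_1)$ adjacent to $(u_2,v_2)$ iff either $u_1=u_2$ and $v_1v_2\in E(H)$, or $v_1=v_2$ and $u_1u_2\in E(G)$. For vertices $x,y$ of a connected graph $G$, $R\{x,y\}$ is the set of $z$ with $d(x,z)\neq d(y,z)$. A resolving function of $G$ is $f:V(G)\to[0,1]$ with $\sum_{z\in R\{x,y\}}f(z)\geq 1$ for all distinct $x,y$; $\dim_f(G)$ is the minimum of $\sum_{v\in V(G)}f(v)$ over all resolving functions. *)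

theory Defs
  imports "HOL-Analysis.Analysis" "Graph_Theory.Graph_Theory"
begin

text \<open>
  A finite simple graph is a \<^locale>\<open>pair_graph\<close>: a finite symmetric loop-free relation on a finite
  vertex set, so that each undirected edge appears as two opposite arcs.
\<close>

definition cartesian_product ::
  "'a pair_pre_digraph \<Rightarrow> 'b pair_pre_digraph \<Rightarrow> ('a \<times> 'b) pair_pre_digraph" where
  "cartesian_product G H =
     \<lparr> pverts = pverts G \<times> pverts H,
       parcs = {((u1, v1), (u2, v2)) | u1 v1 u2 v2.
         (u1 \<in> pverts G \<and> u1 = u2 \<and> (v1, v2) \<in> parcs H) \<or>
         (v1 \<in> pverts H \<and> v1 = v2 \<and> (u1, u2) \<in> parcs G)} \<rparr>"

text \<open>The library's shortest-walk cost with unit weights; it is finite on connected graphs.\<close>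

definition graph_dist :: "'a pair_pre_digraph \<Rightarrow> 'a \<Rightarrow> 'a \<Rightarrow> ereal" where
  "graph_dist G x y = wf_digraph.\<mu> (with_proj G) (\<lambda>_. 1) x y"

definition resolving_set :: "'a pair_pre_digraph \<Rightarrow> 'a \<Rightarrow> 'a \<Rightarrow> 'a set" where
  "resolving_set G x y = {z \<in> pverts G. graph_dist G x z \<noteq> graph_dist G y z}"

text \<open>Values outside the vertex set are unconstrained and are never used.\<close>

definition resolving_function :: "'a pair_pre_digraph \<Rightarrow> ('a \<Rightarrow> real) \<Rightarrow> bool" where
  "resolving_function G f \<longleftrightarrow>
     f \<in> pverts G \<rightarrow> {0..1} \<and>
     (\<forall>x\<in>pverts G. \<forall>y\<in>pverts G. x \<noteq> y \<longrightarrow> (\<Sum>z\<in>resolving_set G x y. f z) \<ge> 1)"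

definition frac_metric_dim :: "'a pair_pre_digraph \<Rightarrow> real" where
  "frac_metric_dim G = (LEAST w. \<exists>f. resolving_function G f \<and> w = (\<Sum>v\<in>pverts G. f v))"

text \<open>
  The remaining facts show that for finite simple graphs the minimum above is attained, so that
  \<^const>\<open>frac_metric_dim\<close> is not an unspecified value of \<^const>\<open>Least\<close>.
\<close>

lemma graph_dist_self:
  assumes "pair_graph G" "x \<in> pverts G"
  shows "graph_dist G x x = 0"
proof -
  interpret pair_graph G by fact
  have "awalk x [] x" using assms by (simp add: awalk_Nil_iff)
  from min_cost_le_walk_cost[OF this, of "\<lambda>_. 1"]
  have "graph_dist G x x \<le> 0" by (simp add: graph_dist_def zero_ereal_def)
  moreover have "graph_dist G x x \<ge> 0"
    unfolding graph_dist_def \<mu>_def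
    by (rule INF_greatest) (auto intro!: pos_cost_pos_awalk_cost)
  ultimately show ?thesis by simp
qed

lemma graph_dist_pos:
  assumes "pair_graph G" "x \<noteq> y"
  shows "graph_dist G x y \<ge> 1"
proof -
  interpret pair_graph G by fact
  have "ereal (awalk_cost (\<lambda>_. 1) p) \<ge> 1" if "awalk x p y" for p
  proof (cases p)
    case Nil
    with that assms show ?thesis by (simp add: awalk_Nil_iff)
  next
    case (Cons e es)
    then have "awalk (snd e) es y" using that by (simp add: awalk_Cons_iff)
    then have "awalk_cost (\<lambda>_. 1) es \<ge> 0" by (rule pos_cost_pos_awalk_cost) simp
    then show ?thesis using Cons by (simp add: one_ereal_def)
  qed
  then show ?thesis unfolding graph_dist_def \<mu>_def by (auto intro!: INF_greatest)
qed

lemma resolving_function_const_one: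
  assumes "pair_graph G"
  shows "resolving_function G (\<lambda>_. 1)"
  unfolding resolving_function_def
proof (intro conjI ballI impI)
  fix x y assume *: "x \<in> pverts G" "y \<in> pverts G" "x \<noteq> y"
  have "graph_dist G x x \<noteq> graph_dist G y x"
    using graph_dist_self[OF assms *(1)] graph_dist_pos[OF assms *(3)[symmetric]] by auto
  then have "x \<in> resolving_set G x y" using * by (simp add: resolving_set_def)
  moreover have "finite (resolving_set G x y)"
    using pair_fin_digraph.pair_finite_verts[of G] assms
    by (auto simp: resolving_set_def pair_graph_def pair_digraph_def)
  ultimately have "card (resolving_set G x y) > 0" by (auto simp: card_gt_0_iff)
  then show "(\<Sum>z\<in>resolving_set G x y. 1::real) \<ge> 1" by simp
qed simp

lemma frac_metric_dim_attained:
  assumes "pair_graph G"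
  shows "\<exists>f. resolving_function G f \<and> frac_metric_dim G = (\<Sum>v\<in>pverts G. f v) \<and>
    (\<forall>g. resolving_function G g \<longrightarrow> frac_metric_dim G \<le> (\<Sum>v\<in>pverts G. g v))"
proof -
  let ?V = "pverts G" and ?w = "\<lambda>f. \<Sum>v\<in>pverts G. f v"
  define B where "B = PiE UNIV (\<lambda>v. if v \<in> ?V then {0..1::real} else {0})"
  define C where "C = (\<Inter>x\<in>?V. \<Inter>y\<in>?V - {x}. {f::'a \<Rightarrow> real. (\<Sum>z\<in>resolving_set G x y. f z) \<ge> 1})"
  have "compactin (product_topology (\<lambda>_. euclidean) UNIV) B"
    unfolding B_def compactin_PiE by auto
  then have "compact B" by (simp add: euclidean_product_topology)
  moreover have "closed C" unfolding C_def
    by (intro closed_INT ballI closed_Collect_le continuous_intros continuous_on_product_coordinates)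
  ultimately have "compact (B \<inter> C)" by (rule compact_Int_closed)
  have cut: "(\<lambda>v. if v \<in> ?V then f v else 0) \<in> B \<inter> C" if "resolving_function G f" for f
  proof
    show "(\<lambda>v. if v \<in> ?V then f v else 0) \<in> B"
      using that by (force simp: B_def resolving_function_def Pi_iff)
    have "(\<Sum>z\<in>resolving_set G x y. if z \<in> ?V then f z else 0) = (\<Sum>z\<in>resolving_set G x y. f z)"
      for x y by (rule sum.cong) (auto simp: resolving_set_def)
    then show "(\<lambda>v. if v \<in> ?V then f v else 0) \<in> C"
      using that by (auto simp: C_def resolving_function_def)
  qed
  have res: "resolving_function G f" if "f \<in> B \<inter> C" for f
  proof -
    from that have "f v \<in> {0..1}" if "v \<in> ?V" for v
      using that by (auto simp: B_def PiE_iff split: if_splits)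
    moreover have "(\<Sum>z\<in>resolving_set G x y. f z) \<ge> 1" if "x \<in> ?V" "y \<in> ?V" "x \<noteq> y" for x y
      using \<open>f \<in> B \<inter> C\<close> that unfolding C_def by blast
    ultimately show ?thesis by (auto simp: resolving_function_def)
  qed
  have "B \<inter> C \<noteq> {}" using cut[OF resolving_function_const_one[OF assms]] by blast
  moreover have "continuous_on (B \<inter> C) ?w"
    by (intro continuous_intros continuous_on_subset[OF continuous_on_product_coordinates]) auto
  ultimately obtain f where f: "f \<in> B \<inter> C" "\<And>g. g \<in> B \<inter> C \<Longrightarrow> ?w f \<le> ?w g"
    using continuous_attains_inf[OF \<open>compact (B \<inter> C)\<close>] by blast
  have min: "?w f \<le> ?w g" if "resolving_function G g" for g
    using f(2)[OF cut[OF that]] by simp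
  have "frac_metric_dim G = ?w f"
    unfolding frac_metric_dim_def by (rule Least_equality) (use res[OF f(1)] min in auto)
  then show ?thesis using res[OF f(1)] min by auto
qed

end

theory Submission
  imports Defs
begin

text \<open>
  If some vertex \<open>v\<close> of \<open>G\<close> lay in no resolving set of size two, the function with value \<open>0\<close> at \<open>v\<close>
  and \<open>1/2\<close> elsewhere would be resolving, so \<open>dim\<^sub>f(G) = |V(G)|/2\<close> forces every vertex \<open>x\<close> to have a
  twin \<open>x'\<close> with \<open>R{x,x'} = {x,x'}\<close>. Using twins, two vertices of \<open>G \<box> H\<close> with distinct first
  coordinates are resolved by at least two vertices in each copy of \<open>G\<close>; if the first coordinates
  agree, they are resolved by two full copies of \<open>G\<close>. In either case at least \<open>2|V(H)|\<close>
  vertices resolve, so the constant function \<open>1/(2|V(H)|)\<close> is resolving. Conversely, summing a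
  resolving function of \<open>G \<box> H\<close> over the copies of \<open>H\<close> gives a resolving function of \<open>G\<close>.
\<close>

section \<open>Distances\<close>

text \<open>Relational powers of \<open>parcs\<close> replace walks so that distances are naturals
  and walks in the product can be split by induction on length. The \<open>LEAST\<close> is
  meaningful only if some walk exists, so the facts below carry a walk or use connectedness.\<close>

definition hop_dist :: "'a pair_pre_digraph \<Rightarrow> 'a \<Rightarrow> 'a \<Rightarrow> nat" where
  "hop_dist G x y = (LEAST n. (x, y) \<in> parcs G ^^ n)"

lemma hop_dist_le: "(x, y) \<in> parcs G ^^ n \<Longrightarrow> hop_dist G x y \<le> n"
  unfolding hop_dist_def by (rule Least_le)

lemma relpow_hop_dist: "(x, y) \<in> parcs G ^^ n \<Longrightarrow> (x, y) \<in> parcs G ^^ hop_dist G x y"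
  unfolding hop_dist_def by (rule LeastI)

lemma (in pair_wf_digraph) awalk_imp_relpow: "awalk x p y \<Longrightarrow> (x, y) \<in> parcs G ^^ length p"
proof (induction p arbitrary: x)
  case Nil
  then show ?case by (simp add: awalk_Nil_iff)
next
  case (Cons e p)
  then have "(x, snd e) \<in> parcs G" "(snd e, y) \<in> parcs G ^^ length p"
    by (auto simp: awalk_Cons_iff)
  then show ?case by (simp only: list.size relpow_Suc_I2 add_0_right add_Suc_right)
qed

lemma (in pair_wf_digraph) relpow_imp_awalk:
  "(x, y) \<in> parcs G ^^ n \<Longrightarrow> x \<in> pverts G \<Longrightarrow> \<exists>p. awalk x p y \<and> length p = n"
proof (induction n arbitrary: x)
  case 0
  \<comment> \<open>The zeroth power is the identity on the whole type, so the empty walk needs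
    \<open>x\<close> to be a vertex.\<close>
  then have "awalk x [] y" by (simp add: awalk_Nil_iff)
  then show ?case by force
next
  case (Suc n)
  then obtain z where z: "(x, z) \<in> parcs G" "(z, y) \<in> parcs G ^^ n"
    by (meson relpow_Suc_D2)
  then have "z \<in> pverts G" by (auto dest: in_arcsD2)
  with Suc.IH z obtain p where "awalk z p y" "length p = n" by blast
  with z have "awalk x ((x, z) # p) y" by (simp add: awalk_Cons_iff)
  with \<open>length p = n\<close> show ?case by (metis length_Cons)
qed

lemma graph_dist_eq_hop_dist:
  assumes "pair_graph G" "x \<in> pverts G" "(x, y) \<in> parcs G ^^ n"
  shows "graph_dist G x y = ereal (real (hop_dist G x y))"
proof -
  interpret pair_graph G by fact
  have cost: "awalk_cost (\<lambda>_. 1) p = real (length p)" for p :: "('a \<times> 'a) list"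
    by (induction p) auto
  obtain p where p: "awalk x p y" "length p = hop_dist G x y"
    using relpow_imp_awalk[OF relpow_hop_dist] assms by blast
  have "graph_dist G x y \<le> ereal (real (hop_dist G x y))"
    using min_cost_le_walk_cost[OF p(1), of "\<lambda>_. 1"] p(2) by (simp add: graph_dist_def cost)
  moreover have "graph_dist G x y \<ge> ereal (real (hop_dist G x y))"
    unfolding graph_dist_def \<mu>_def
    by (rule INF_greatest) (auto simp: cost intro!: hop_dist_le awalk_imp_relpow)
  ultimately show ?thesis by (rule antisym)
qed

section \<open>Distances and resolving sets in a connected graph\<close>

locale connected_pair_graph = pair_graph G for G :: "'a pair_pre_digraph" +
  assumes connected: "Digraph_Component.connected (with_proj G)"
begin

abbreviation d :: "'a \<Rightarrow> 'a \<Rightarrow> nat" where "d \<equiv> hop_dist G"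

lemma verts_nonempty: "pverts G \<noteq> {}"
  using connected by (auto simp: connected_def strongly_connected_def)

lemma ex_relpow:
  assumes "x \<in> pverts G" "y \<in> pverts G"
  shows "\<exists>n. (x, y) \<in> parcs G ^^ n"
proof -
  \<comment> \<open>\<open>connected\<close> speaks of the symmetric closure; the arcs are already
    symmetric, so directed walks exist.\<close>
  have "strongly_connected (with_proj G)"
    by (rule symmetric_connected_imp_strongly_connected[OF pair_sym_arcs connected])
  then have "x \<rightarrow>\<^sup>*\<^bsub>with_proj G\<^esub> y"
    using assms by (auto simp: strongly_connected_def)
  then show ?thesis by (auto simp: reachable_awalk dest: awalk_imp_relpow)
qed

lemma relpow_dist: "x \<in> pverts G \<Longrightarrow> y \<in> pverts G \<Longrightarrow> (x, y) \<in> parcs G ^^ d x y"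
  using ex_relpow by (blast intro: relpow_hop_dist)

lemma graph_dist_eq:
  "x \<in> pverts G \<Longrightarrow> y \<in> pverts G \<Longrightarrow> graph_dist G x y = ereal (real (d x y))"
  using ex_relpow by (blast intro: graph_dist_eq_hop_dist[OF pair_graph])

lemma dist_self [simp]: "d x x = 0"
  using hop_dist_le[of x x 0 G] by simp

lemma dist_pos: "x \<in> pverts G \<Longrightarrow> y \<in> pverts G \<Longrightarrow> x \<noteq> y \<Longrightarrow> d x y > 0"
  using relpow_dist[of x y] by (cases "d x y") auto

lemma relpow_sym: "(x, y) \<in> parcs G ^^ n \<Longrightarrow> (y, x) \<in> parcs G ^^ n"
proof (induction n arbitrary: x)
  case (Suc n)
  then obtain z where z: "(x, z) \<in> parcs G" "(z, y) \<in> parcs G ^^ n"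
    by (meson relpow_Suc_D2)
  then show ?case using Suc.IH arcs_symmetric by (meson relpow_Suc_I)
qed simp

lemma dist_commute: "d x y = d y x"
proof -
  have "(x, y) \<in> parcs G ^^ n \<longleftrightarrow> (y, x) \<in> parcs G ^^ n" for n
    using relpow_sym by blast
  then show ?thesis by (simp add: hop_dist_def)
qed

lemma dist_triangle:
  assumes "x \<in> pverts G" "y \<in> pverts G" "z \<in> pverts G"
  shows "d x z \<le> d x y + d y z"
  by (rule hop_dist_le, rule relpow_trans) (use assms relpow_dist in auto)

lemma resolving_set_eq:
  assumes "x \<in> pverts G" "y \<in> pverts G"
  shows "resolving_set G x y = {z \<in> pverts G. d x z \<noteq> d y z}"
  using assms by (auto simp: resolving_set_def graph_dist_eq)

lemma resolving_set_commute: "resolving_set G x y = resolving_set G y x"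
  unfolding resolving_set_def by metis

lemma finite_resolving_set: "finite (resolving_set G x y)"
  by (simp add: resolving_set_def)

lemma endpoints_in_resolving_set:
  assumes "x \<in> pverts G" "y \<in> pverts G" "x \<noteq> y"
  shows "{x, y} \<subseteq> resolving_set G x y"
  using assms dist_pos[of x y] dist_commute[of x y] by (simp add: resolving_set_eq)

section \<open>Twins\<close>

lemma ex_twin:
  assumes dim: "frac_metric_dim G = real (card (pverts G)) / 2" and v: "v \<in> pverts G"
  obtains v' where "v' \<in> pverts G" "v' \<noteq> v" "resolving_set G v v' = {v, v'}"
proof (rule ccontr)
  assume "\<not> thesis"
  with that have no_twin: "resolving_set G v y \<noteq> {v, y}" if "y \<in> pverts G" "y \<noteq> v" for y
    using \<open>y \<in> pverts G\<close> \<open>y \<noteq> v\<close> by blast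
  define f where "f z = (if z = v then 0 else 1/2 :: real)" for z
  have sum_f: "(\<Sum>z\<in>A. f z) = real (card (A - {v})) / 2" if "finite A" for A
    using that by (simp add: f_def sum.If_cases Diff_eq Compl_eq)
  have "resolving_function G f"
    unfolding resolving_function_def
  proof (intro conjI ballI impI)
    fix x y assume xy: "x \<in> pverts G" "y \<in> pverts G" "x \<noteq> y"
    let ?R = "resolving_set G x y"
    have sub: "{x, y} \<subseteq> ?R" by (rule endpoints_in_resolving_set[OF xy])
    \<comment> \<open>Two resolving vertices of weight \<open>1/2\<close> suffice. If
      \<open>v\<close> is an endpoint, the lack of a twin gives a third resolving vertex to join the
      other endpoint; otherwise \<open>x\<close> and \<open>y\<close> themselves serve.\<close>
    have "\<exists>s t. s \<noteq> t \<and> {s, t} \<subseteq> ?R - {v}"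
    proof (cases "v \<in> {x, y}")
      case True
      then have "?R \<noteq> {x, y}"
        using no_twin[of y] no_twin[of x] xy resolving_set_commute[of x y] by auto
      with sub obtain s where "s \<in> ?R" "s \<notin> {x, y}" by blast
      with sub xy True show ?thesis by blast
    next
      case False
      with sub xy show ?thesis by blast
    qed
    then obtain s t where "s \<noteq> t" "{s, t} \<subseteq> ?R - {v}" by blast
    then have "2 \<le> card (?R - {v})"
      using card_mono[of "?R - {v}" "{s, t}"] finite_resolving_set by auto
    then show "1 \<le> (\<Sum>z\<in>?R. f z)" by (simp add: sum_f finite_resolving_set)
  qed (simp add: f_def)
  then have "frac_metric_dim G \<le> (\<Sum>z\<in>pverts G. f z)"
    using frac_metric_dim_attained[OF pair_graph] by blast
  also have "\<dots> = real (card (pverts G - {v})) / 2" by (rule sum_f) simp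
  also have "\<dots> < real (card (pverts G)) / 2"
    using psubset_card_mono[of "pverts G" "pverts G - {v}"] v by auto
  finally show False using dim by simp
qed

lemma twin_dist_eq:
  assumes "x \<in> pverts G" "x' \<in> pverts G" "resolving_set G x x' = {x, x'}"
    "z \<in> pverts G" "z \<notin> {x, x'}"
  shows "d x z = d x' z"
  using assms by (auto simp: resolving_set_eq)

text \<open>
  The value \<open>d x s - d y s\<close> is at most \<open>d x y\<close>, with equality at \<open>s = y\<close>. The twin of \<open>y\<close> has a
  smaller value unless it is \<open>x\<close>, in which case the value at any third vertex is zero.
\<close>
lemma ex_not_beyond:
  assumes dim: "frac_metric_dim G = real (card (pverts G)) / 2" and card: "card (pverts G) \<ge> 3"
    and xy: "x \<in> pverts G" "y \<in> pverts G" "x \<noteq> y"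
  shows "\<exists>s\<in>pverts G. s \<noteq> x \<and> d x s \<noteq> d y s + d x y"
proof -
  obtain y' where y': "y' \<in> pverts G" "y' \<noteq> y" "resolving_set G y y' = {y, y'}"
    using ex_twin[OF dim xy(2)] .
  show ?thesis
  proof (cases "y' = x")
    case True
    have "\<not> pverts G \<subseteq> {x, y}"
      using card_mono[of "{x, y}" "pverts G"] card xy by auto
    then obtain s where s: "s \<in> pverts G" "s \<notin> {x, y}" by blast
    then have "d y s = d x s"
      using twin_dist_eq[OF xy(2) y'(1,3)] True by auto
    then have "d x s \<noteq> d y s + d x y" using dist_pos[OF xy] by simp
    then show ?thesis using s by blast
  next
    case False
    then have "d x y' = d x y"
      using twin_dist_eq[OF xy(2) y'(1,3) xy(1)] xy dist_commute by simp
    then have "d x y' \<noteq> d y y' + d x y" using dist_pos[of y y'] y' xy by simp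
    then show ?thesis using y' False by blast
  qed
qed

text \<open>In the product, \<open>p\<close> and \<open>q\<close> become the distances in
  \<open>H\<close> from the two second coordinates to a fixed vertex. The inequality fails at
  \<open>u = y\<close> iff \<open>q = d x y + p\<close>, and at \<open>u = x\<close> iff
  \<open>p = d x y + q\<close>. As \<open>d x y > 0\<close>, at most one endpoint fails, and
  \<open>ex_not_beyond\<close> supplies a replacement for it.\<close>

lemma ex_two_unbalanced:
  assumes dim: "frac_metric_dim G = real (card (pverts G)) / 2" and card: "card (pverts G) \<ge> 3"
    and xy: "x \<in> pverts G" "y \<in> pverts G" "x \<noteq> y"
  shows "\<exists>s t. s \<noteq> t \<and> {s, t} \<subseteq> {u \<in> pverts G. d x u + p \<noteq> d y u + q}"
proof -
  have pos: "d x y > 0" using dist_pos[OF xy] .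
  consider "q = d x y + p" | "p = d x y + q" | "q \<noteq> d x y + p" "p \<noteq> d x y + q" by blast
  then show ?thesis
  proof cases
    case 1
    obtain s where "s \<in> pverts G" "s \<noteq> x" "d x s \<noteq> d y s + d x y"
      using ex_not_beyond[OF dim card xy] by blast
    then have "s \<noteq> x \<and> {s, x} \<subseteq> {u \<in> pverts G. d x u + p \<noteq> d y u + q}"
      using 1 pos xy by auto
    then show ?thesis by blast
  next
    case 2
    obtain s where "s \<in> pverts G" "s \<noteq> y" "d y s \<noteq> d x s + d x y"
      using ex_not_beyond[OF dim card xy(2,1)] xy dist_commute[of x y] by auto
    then have "s \<noteq> y \<and> {s, y} \<subseteq> {u \<in> pverts G. d x u + p \<noteq> d y u + q}"
      using 2 pos xy by auto
    then show ?thesis by blast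
  next
    case 3
    then have "x \<noteq> y \<and> {x, y} \<subseteq> {u \<in> pverts G. d x u + p \<noteq> d y u + q}"
      using xy dist_commute[of x y] by auto
    then show ?thesis by blast
  qed
qed

end

section \<open>Cartesian products\<close>

lemma pverts_cartesian_product [simp]:
  "pverts (cartesian_product G H) = pverts G \<times> pverts H"
  by (simp add: cartesian_product_def)

lemma in_parcs_cartesian_product:
  "((u, a), (v, b)) \<in> parcs (cartesian_product G H) \<longleftrightarrow>
     u \<in> pverts G \<and> u = v \<and> (a, b) \<in> parcs H \<or> a \<in> pverts H \<and> a = b \<and> (u, v) \<in> parcs G"
  by (auto simp: cartesian_product_def)

lemma pair_graph_cartesian_product:
  assumes "pair_graph G" "pair_graph H"
  shows "pair_graph (cartesian_product G H)"
proof -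
  interpret G: pair_graph G by fact
  interpret H: pair_graph H by fact
  let ?P = "cartesian_product G H"
  have wf: "e \<in> pverts ?P \<times> pverts ?P" if "e \<in> parcs ?P" for e
    using that by (cases e)
      (auto simp: in_parcs_cartesian_product dest: G.wellformed' H.wellformed')
  then have "parcs ?P \<subseteq> pverts ?P \<times> pverts ?P" by blast
  then have fin: "finite (parcs ?P)" by (rule finite_subset) simp
  have loop: "fst e \<noteq> snd e" if "e \<in> parcs ?P" for e
    using that by (cases e)
      (auto simp: in_parcs_cartesian_product dest: G.no_loops' H.no_loops')
  have "sym (parcs ?P)"
    by (rule symI) (auto simp: in_parcs_cartesian_product intro: G.arcs_symmetric H.arcs_symmetric)
  then have sym: "symmetric (with_proj ?P)" by (simp add: symmetric_def)
  have "pair_wf_digraph ?P" using wf by (simp add: pair_wf_digraph_def mem_Times_iff)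
  moreover have "pair_fin_digraph_axioms ?P" using fin by (simp add: pair_fin_digraph_axioms_def)
  moreover have "pair_loopfree_digraph_axioms ?P"
    using loop by (simp only: pair_loopfree_digraph_axioms_def) blast
  moreover have "pair_sym_digraph_axioms ?P" using sym by (simp only: pair_sym_digraph_axioms_def)
  ultimately show ?thesis
    by (simp only: pair_graph_def pair_digraph_def pair_pseudo_graph_def pair_fin_digraph_def
        pair_loopfree_digraph_def pair_sym_digraph_def)
qed

locale connected_pair_graphs = G: connected_pair_graph G + H: connected_pair_graph H
  for G :: "'a pair_pre_digraph" and H :: "'b pair_pre_digraph"
begin

abbreviation P :: "('a \<times> 'b) pair_pre_digraph" where "P \<equiv> cartesian_product G H"

section \<open>Walks and distances in the product\<close>

lemma relpow_product_fst:
  "(u, v) \<in> parcs G ^^ n \<Longrightarrow> a \<in> pverts H \<Longrightarrow> ((u, a), (v, a)) \<in> parcs P ^^ n"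
proof (induction n arbitrary: v)
  case (Suc n)
  then obtain w where "(u, w) \<in> parcs G ^^ n" "(w, v) \<in> parcs G" by auto
  with Suc have "((u, a), (w, a)) \<in> parcs P ^^ n" "((w, a), (v, a)) \<in> parcs P"
    by (auto simp: in_parcs_cartesian_product)
  then show ?case by (rule relpow_Suc_I)
qed simp

lemma relpow_product_snd:
  "(a, b) \<in> parcs H ^^ n \<Longrightarrow> u \<in> pverts G \<Longrightarrow> ((u, a), (u, b)) \<in> parcs P ^^ n"
proof (induction n arbitrary: b)
  case (Suc n)
  then obtain c where "(a, c) \<in> parcs H ^^ n" "(c, b) \<in> parcs H" by auto
  with Suc have "((u, a), (u, c)) \<in> parcs P ^^ n" "((u, c), (u, b)) \<in> parcs P"
    by (auto simp: in_parcs_cartesian_product)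
  then show ?case by (rule relpow_Suc_I)
qed simp

text \<open>Each arc of the product is a step in a single factor, so the steps of a walk sort into a
  walk in \<open>G\<close> and a walk in \<open>H\<close>. This bounds product distances from
  below.\<close>

lemma relpow_product_split:
  "((u, a), (v, b)) \<in> parcs P ^^ n \<Longrightarrow>
     \<exists>i j. n = i + j \<and> (u, v) \<in> parcs G ^^ i \<and> (a, b) \<in> parcs H ^^ j"
proof (induction n arbitrary: v b)
  case (Suc n)
  then obtain w c where wc: "((u, a), (w, c)) \<in> parcs P ^^ n" "((w, c), (v, b)) \<in> parcs P"
    by (auto elim: relpow_Suc_E)
  from Suc.IH[OF wc(1)] obtain i j where
    ij: "n = i + j" "(u, w) \<in> parcs G ^^ i" "(a, c) \<in> parcs H ^^ j" by blast
  from wc(2) consider "w = v" "(c, b) \<in> parcs H" | "c = b" "(w, v) \<in> parcs G"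
    by (auto simp: in_parcs_cartesian_product)
  then show ?case
  proof cases
    case 1
    with ij have "Suc n = i + Suc j" "(a, b) \<in> parcs H ^^ Suc j" by auto
    with 1 ij show ?thesis by blast
  next
    case 2
    with ij have "Suc n = Suc i + j" "(u, v) \<in> parcs G ^^ Suc i" by auto
    with 2 ij show ?thesis by blast
  qed
qed simp

lemma graph_dist_product:
  assumes "u \<in> pverts G" "v \<in> pverts G" "a \<in> pverts H" "b \<in> pverts H"
  shows "graph_dist P (u, a) (v, b) = ereal (real (G.d u v + H.d a b))"
proof -
  \<comment> \<open>Walk to \<open>(v, a)\<close> inside a copy of \<open>G\<close>, then to
    \<open>(v, b)\<close> inside a copy of \<open>H\<close>.\<close>
  have walk: "((u, a), (v, b)) \<in> parcs P ^^ (G.d u v + H.d a b)"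
    by (rule relpow_trans[OF relpow_product_fst relpow_product_snd])
      (use assms G.relpow_dist H.relpow_dist in auto)
  obtain i j where "hop_dist P (u, a) (v, b) = i + j"
    "(u, v) \<in> parcs G ^^ i" "(a, b) \<in> parcs H ^^ j"
    using relpow_product_split[OF relpow_hop_dist[OF walk]] by blast
  then have "G.d u v + H.d a b \<le> hop_dist P (u, a) (v, b)"
    by (simp only: hop_dist_le add_mono)
  with hop_dist_le[OF walk] have "hop_dist P (u, a) (v, b) = G.d u v + H.d a b"
    by (rule antisym)
  moreover have "graph_dist P (u, a) (v, b) = ereal (real (hop_dist P (u, a) (v, b)))"
    by (rule graph_dist_eq_hop_dist[OF pair_graph_cartesian_product[OF G.pair_graph H.pair_graph] _ walk])
      (simp add: assms)
  ultimately show ?thesis by simp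
qed

section \<open>Resolving sets of the product\<close>

lemma resolving_set_product:
  assumes "x \<in> pverts G" "y \<in> pverts G" "a \<in> pverts H" "b \<in> pverts H"
  shows "resolving_set P (x, a) (y, b) =
    {(u, w) \<in> pverts G \<times> pverts H. G.d x u + H.d a w \<noteq> G.d y u + H.d b w}"
  using assms by (auto simp: resolving_set_def graph_dist_product)

text \<open>The common term \<open>H.d a w\<close> cancels. These pairs alone suffice to carry
  resolving functions from the product down to \<open>G\<close>.\<close>

lemma resolving_set_product_slice:
  assumes "x \<in> pverts G" "y \<in> pverts G" "a \<in> pverts H"
  shows "resolving_set P (x, a) (y, a) = resolving_set G x y \<times> pverts H"
  using assms by (auto simp: resolving_set_product G.resolving_set_eq)

lemma card_resolving_set_product:
  assumes dim: "frac_metric_dim G = real (card (pverts G)) / 2" and card: "card (pverts G) \<ge> 3"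
    and card_le: "card (pverts H) \<le> card (pverts G)"
    and verts: "x \<in> pverts G" "y \<in> pverts G" "a \<in> pverts H" "b \<in> pverts H"
    and neq: "(x, a) \<noteq> (y, b)"
  shows "2 * card (pverts H) \<le> card (resolving_set P (x, a) (y, b))" (is "_ \<le> card ?R")
proof -
  have fin: "finite ?R" by (simp add: resolving_set_def)
  show ?thesis
  proof (cases "x = y")
    case True
    \<comment> \<open>At \<open>(u, a)\<close> and \<open>(u, b)\<close> the two distances differ by
      \<open>H.d a b\<close>, which is positive. The assumption \<open>card_le\<close> then turns
      two copies of \<open>G\<close> into the required bound.\<close>
    then have "pverts G \<times> {a, b} \<subseteq> ?R"
      using verts neq H.dist_pos[of a b] H.dist_commute[of a b]
      by (auto simp: resolving_set_product)
    then have "card (pverts G \<times> {a, b}) \<le> card ?R" using fin by (rule card_mono[rotated])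
    then show ?thesis using True neq card_le by (simp add: card_cartesian_product)
  next
    case False
    \<comment> \<open>\<open>U w\<close> is the fibre of \<open>?R\<close> over \<open>w\<close>;
      the count sums the fibres. \<open>Sigma\<close> puts the coordinate in \<open>H\<close> first,
      hence the later \<open>prod.swap\<close>.\<close>
    define U where "U w = {u \<in> pverts G. G.d x u + H.d a w \<noteq> G.d y u + H.d b w}" for w
    have finU: "finite (U w)" for w by (simp add: U_def)
    have "2 \<le> card (U w)" for w
    proof -
      obtain s t where "s \<noteq> t" "{s, t} \<subseteq> U w"
        using G.ex_two_unbalanced[OF dim card verts(1,2) False, of "H.d a w" "H.d b w"]
        unfolding U_def by blast
      then show ?thesis using card_mono[OF finU, of "{s, t}" w] by simp
    qed
    then have "(\<Sum>w\<in>pverts H. 2) \<le> (\<Sum>w\<in>pverts H. card (U w))" by (intro sum_mono)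
    also have "\<dots> = card (Sigma (pverts H) U)" using finU by simp
    also have "\<dots> = card (prod.swap ` Sigma (pverts H) U)"
      by (simp add: card_image)
    also have "prod.swap ` Sigma (pverts H) U = ?R"
      using verts by (force simp: resolving_set_product U_def)
    finally show ?thesis by simp
  qed
qed

section \<open>Upper and lower bounds for the product\<close>

lemma ex_resolving_function_product:
  assumes "frac_metric_dim G = real (card (pverts G)) / 2" "card (pverts G) \<ge> 3"
    "card (pverts H) \<le> card (pverts G)"
  shows "\<exists>f. resolving_function P f \<and> (\<Sum>v\<in>pverts P. f v) = real (card (pverts G)) / 2"
proof (intro exI conjI)
  let ?h = "real (card (pverts H))"
  let ?f = "\<lambda>_ :: 'a \<times> 'b. 1 / (2 * ?h)"
  have "card (pverts H) > 0" using H.verts_nonempty by (simp add: card_gt_0_iff)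
  \<comment> \<open>This keeps the constant \<open>1 / (2 * ?h)\<close> within the unit
    interval.\<close>
  then have h: "?h \<ge> 1" by linarith
  show "resolving_function P ?f"
    unfolding resolving_function_def
  proof (intro conjI ballI impI)
    fix X Y assume "X \<in> pverts P" "Y \<in> pverts P" "X \<noteq> Y"
    then have "2 * card (pverts H) \<le> card (resolving_set P X Y)"
      using card_resolving_set_product[OF assms] by (cases X; cases Y) simp
    then have "2 * ?h \<le> real (card (resolving_set P X Y))" by linarith
    then show "1 \<le> (\<Sum>z\<in>resolving_set P X Y. ?f z)" using h by (simp add: field_simps)
  qed (use h in \<open>auto simp: field_simps\<close>)
  show "(\<Sum>v\<in>pverts P. ?f v) = real (card (pverts G)) / 2"
    using H.verts_nonempty by (simp add: card_cartesian_product)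
qed

lemma frac_metric_dim_le_product:
  assumes f: "resolving_function P f"
  shows "frac_metric_dim G \<le> (\<Sum>v\<in>pverts P. f v)"
proof -
  obtain a where a: "a \<in> pverts H" using H.verts_nonempty by blast
  define F where "F u = (\<Sum>w\<in>pverts H. f (u, w))" for u
  have F0: "F u \<ge> 0" if "u \<in> pverts G" for u
    unfolding F_def using f that by (intro sum_nonneg) (auto simp: resolving_function_def Pi_iff)
  \<comment> \<open>The sum over a copy of \<open>H\<close> may exceed 1, so it is truncated to stay
    in the unit interval.\<close>
  have "resolving_function G (\<lambda>u. min 1 (F u))"
    unfolding resolving_function_def
  proof (intro conjI ballI impI)
    fix x y assume xy: "x \<in> pverts G" "y \<in> pverts G" "x \<noteq> y"
    let ?R = "resolving_set G x y"
    have sub: "?R \<subseteq> pverts G" by (auto simp: resolving_set_def)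
    show "1 \<le> (\<Sum>u\<in>?R. min 1 (F u))"
    \<comment> \<open>One truncated value already contributes 1, or truncation changes nothing on
      \<open>?R\<close> and the pair \<open>(x, a)\<close>, \<open>(y, a)\<close> gives the
      bound.\<close>
    proof (cases "\<exists>u\<in>?R. F u \<ge> 1")
      case True
      then obtain u where "u \<in> ?R" "F u \<ge> 1" by blast
      then show ?thesis
        using member_le_sum[of u ?R "\<lambda>u. min 1 (F u)"] F0 sub G.finite_resolving_set by force
    next
      case False
      have "1 \<le> (\<Sum>z\<in>resolving_set P (x, a) (y, a). f z)"
        using f xy a by (auto simp: resolving_function_def)
      also have "\<dots> = (\<Sum>u\<in>?R. F u)"
        using xy a by (simp add: resolving_set_product_slice F_def sum.cartesian_product)
      also have "\<dots> = (\<Sum>u\<in>?R. min 1 (F u))"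
        using False by (intro sum.cong) auto
      finally show ?thesis .
    qed
  qed (use F0 in auto)
  then have "frac_metric_dim G \<le> (\<Sum>u\<in>pverts G. min 1 (F u))"
    using frac_metric_dim_attained[OF G.pair_graph] by blast
  \<comment> \<open>Truncation only lowers the total, which is the right direction for a lower bound
    on the weight of \<open>f\<close>.\<close>
  also have "\<dots> \<le> (\<Sum>u\<in>pverts G. F u)" by (intro sum_mono) simp
  also have "\<dots> = (\<Sum>v\<in>pverts P. f v)" by (simp add: F_def sum.cartesian_product)
  finally show ?thesis .
qed

end

theorem theorem4p3:
  fixes G :: "'a pair_pre_digraph" and H :: "'b pair_pre_digraph"
  assumes "pair_graph G" and "Digraph_Component.connected (with_proj G)"
    and "card (pverts G) \<ge> 3"
    and "frac_metric_dim G = real (card (pverts G)) / 2"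
    and "pair_graph H" and "Digraph_Component.connected (with_proj H)"
    and "card (pverts H) \<le> card (pverts G)"
  shows "frac_metric_dim (cartesian_product G H) = real (card (pverts G)) / 2"
proof -
  interpret connected_pair_graphs G H
    using assms by (simp add: connected_pair_graphs_def connected_pair_graph_def
        connected_pair_graph_axioms_def)
  obtain f where "resolving_function P f" "(\<Sum>v\<in>pverts P. f v) = real (card (pverts G)) / 2"
    using ex_resolving_function_product assms by blast
  moreover have "real (card (pverts G)) / 2 \<le> (\<Sum>v\<in>pverts P. g v)"
    if "resolving_function P g" for g
    using frac_metric_dim_le_product[OF that] assms by simp
  ultimately show ?thesis
    unfolding frac_metric_dim_def by (intro Least_equality) auto
qed

end
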